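(* Let $H_1$ and $H_2$ be finite groups and let $G = H_1 \times H_2$. Then either $\sigma(G)=\min\{\sigma(H_1),\sigma(H_2)\}$, or there is a prime number $p$ such that $\sigma(G)=p+1$ and the cyclic group of order $p$ is a homomorphic image of both $H_1$ and $H_2$.
   Context: For a non-cyclic finite group $G$, a cover of $G$ is a finite collection of proper subgroups of $G$ whose set-theoretical union is $G$; a minimal cover is a cover of least cardinality, and $\sigma(G)$ denotes the cardinality of a minimal cover of $G$. If $G$ is a cyclic finite group, one sets $\sigma(G)=\infty$ (with the convention that $\infty$ is larger than every integer). *)

theory Defs
  imports
    "HOL-Algebra.Elementary_Groups"
    "HOL-Computational_Algebra.Primes"
    "HOL-Library.Extended_Nat"
begin

definition group_cover :: "('a, 'c) monoid_scheme \<Rightarrow> 'a set set \<Rightarrow> bool" where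
  "group_cover G C \<longleftrightarrow>
     finite C \<and> (\<forall>K\<in>C. subgroup K G \<and> K \<noteq> carrier G) \<and> \<Union>C = carrier G"

definition minimal_group_cover :: "('a, 'c) monoid_scheme \<Rightarrow> 'a set set \<Rightarrow> bool" where
  "minimal_group_cover G C \<longleftrightarrow>
     group_cover G C \<and> (\<forall>D. group_cover G D \<longrightarrow> card C \<le> card D)"

text \<open>
  The definition is meant for finite groups only; for these, \<open>covering_number_eq_card\<close> and
  \<open>minimal_group_cover_exists\<close> below show that the least element is always attained in the
  non-cyclic case. The trivial group counts as cyclic.
\<close>

definition covering_number :: "('a, 'c) monoid_scheme \<Rightarrow> enat" where
  "covering_number G =
     (if cyclic_group G then \<infinity>
      else enat (LEAST n. \<exists>C. group_cover G C \<and> card C = n))"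

lemma covering_number_eq_card:
  assumes "\<not> cyclic_group G" and "minimal_group_cover G C"
  shows "covering_number G = enat (card C)"
proof -
  have "(LEAST n. \<exists>C. group_cover G C \<and> card C = n) = card C"
    using assms(2) by (intro Least_equality) (auto simp: minimal_group_cover_def)
  then show ?thesis
    using assms(1) by (simp add: covering_number_def)
qed

lemma (in group) group_cover_exists:
  assumes "finite (carrier G)" and "\<not> cyclic_group G"
  shows "\<exists>C. group_cover G C"
proof (intro exI)
  let ?C = "(\<lambda>x. generate G {x}) ` carrier G"
  have sub: "subgroup (generate G {x}) G" if "x \<in> carrier G" for x
    using that by (intro generate_is_subgroup) auto
  have "generate G {x} \<noteq> carrier G" if x: "x \<in> carrier G" for x
  proof
    assume "generate G {x} = carrier G"
    then have "carrier G = range (\<lambda>n::int. x [^] n)"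
      using generate_pow[OF x] by (simp add: full_SetCompr_eq)
    then show False
      using assms(2) x cyclic_group by blast
  qed
  moreover have "\<Union>?C = carrier G"
    using subgroup.subset[OF sub] by (auto intro: generate.incl)
  ultimately show "group_cover G ?C"
    using assms(1) sub by (auto simp: group_cover_def)
qed

lemma (in group) minimal_group_cover_exists:
  assumes "finite (carrier G)" and "\<not> cyclic_group G"
  shows "\<exists>C. minimal_group_cover G C"
proof -
  obtain C where "group_cover G C"
    using group_cover_exists[OF assms] by blast
  then show ?thesis
    using ex_has_least_nat[of "group_cover G" C card]
    by (auto simp: minimal_group_cover_def)
qed

end

theory Submission
  imports Defs "HOL-Algebra.Multiplicative_Group"
begin

text \<open>
  Let \<open>C\<close> be a minimal cover of \<open>H1 \<times> H2\<close>. If some \<open>K\<close> in \<open>C\<close> projects onto \<open>H1\<close> and has a fibre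
  over \<open>H1\<close> that generates \<open>H2\<close>, then \<open>K\<close> lies in \<open>{(x, y). f x = g y}\<close> for epimorphisms \<open>f\<close>, \<open>g\<close>
  onto the group of prime order \<open>p\<close>. An irredundant cover with a member contained in a normal
  subgroup of index \<open>p\<close> has at least \<open>p + 1\<close> members, and \<open>p + 1\<close> subgroups suffice because the square
  of the cyclic group of order \<open>p\<close> is an image of \<open>H1 \<times> H2\<close>. Otherwise, either the proper
  projections to \<open>H1\<close> of members of \<open>C\<close> cover \<open>H1\<close>, or they miss some \<open>w\<close>, and then the subgroups
  generated by the fibres over \<open>w\<close> of the remaining members are proper and cover \<open>H2\<close>.
\<close>

section \<open>Covers, and covering numbers under epimorphisms\<close>

lemma (in group_hom) subgroup_preimage:
  assumes "subgroup K H"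
  shows "subgroup {x \<in> carrier G. h x \<in> K} G"
proof -
  interpret K: subgroup K H by (rule assms)
  show ?thesis
    by (rule G.subgroupI) (auto intro: K.one_closed K.m_closed)
qed

text \<open>A member containing a generator would contain all its powers, hence be the whole
  group.\<close>

lemma (in group) group_cover_imp_not_cyclic:
  assumes "group_cover G C"
  shows "\<not> cyclic_group G"
proof
  assume "cyclic_group G"
  then obtain x where x: "x \<in> carrier G" "carrier G = range (\<lambda>n::int. x [^] n)"
    using cyclic_group by blast
  have "x \<in> \<Union>C"
    using x(1) assms by (simp add: group_cover_def)
  then obtain K where K: "K \<in> C" "x \<in> K"
    by blast
  then have sub: "subgroup K G" "K \<noteq> carrier G"
    using assms by (auto simp: group_cover_def)
  have "carrier G \<subseteq> K"
    unfolding x(2) using subgroup_int_pow_closed[OF sub(1) K(2)] by auto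
  then show False
    using sub subgroup.subset by blast
qed

text \<open>A group with a cover is not cyclic, so the value \<infinity> does not arise
  here.\<close>

lemma (in group) covering_number_le_card:
  assumes "group_cover G C"
  shows "covering_number G \<le> enat (card C)"
  using assms group_cover_imp_not_cyclic[OF assms]
  by (auto simp: covering_number_def intro!: Least_le)

text \<open>The preimages of the members of a minimal cover of \<open>H\<close> cover
  \<open>G\<close>, and they stay proper because \<open>f\<close> is onto.\<close>

lemma covering_number_epi_le:
  assumes "group G" and "group H" and "finite (carrier H)" and f: "f \<in> epi G H"
  shows "covering_number G \<le> covering_number H"
proof (cases "cyclic_group H")
  case True
  then show ?thesis by (simp add: covering_number_def)
next
  case False
  interpret group_hom G H f
    using assms by (auto simp: group_hom_def group_hom_axioms_def epi_def)
  have surj: "f ` carrier G = carrier H"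
    using f by (simp add: epi_def)
  obtain C where C: "minimal_group_cover H C"
    using H.minimal_group_cover_exists[OF assms(3) False] by blast
  let ?pre = "\<lambda>K. {x \<in> carrier G. f x \<in> K}"
  have cov: "group_cover H C"
    using C by (simp add: minimal_group_cover_def)
  have "?pre K \<noteq> carrier G" if "K \<in> C" for K
  proof
    assume "?pre K = carrier G"
    then have "f ` carrier G \<subseteq> K"
      by blast
    then have "carrier H \<subseteq> K"
      by (simp add: surj)
    moreover have "subgroup K H" "K \<noteq> carrier H"
      using cov that by (auto simp: group_cover_def)
    ultimately show False
      using subgroup.subset by blast
  qed
  moreover have "\<Union>(?pre ` C) = carrier G"
    using cov by (auto simp: group_cover_def)
  ultimately have "group_cover G (?pre ` C)"
    using cov subgroup_preimage by (auto simp: group_cover_def)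
  then have "covering_number G \<le> enat (card (?pre ` C))"
    by (rule G.covering_number_le_card)
  also have "\<dots> \<le> enat (card C)"
    using cov by (auto simp: group_cover_def intro: card_image_le)
  also have "\<dots> = covering_number H"
    using covering_number_eq_card[OF False C] by simp
  finally show ?thesis .
qed

section \<open>Epimorphisms onto finite cyclic groups\<close>

text \<open>Send a power of a generator to its exponent modulo \<open>p\<close>.\<close>

lemma (in group) cyclic_group_epi_integer_mod_group:
  assumes "cyclic_group G" and "p dvd order G" and "p > 0"
  shows "\<exists>f. f \<in> epi G (integer_mod_group p)"
proof -
  obtain q where q: "q \<in> carrier G" "carrier G = range (\<lambda>n::int. q [^] n)"
    using assms(1) cyclic_group by blast
  have "carrier G = generate G {q}"
    using q generate_pow[OF q(1)] by auto
  then have "order G = ord q"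
    using generate_pow_card[OF q(1)] by (simp add: order_def)
  then have dvd: "int p dvd int (ord q)"
    using assms(2) by simp
  \<comment> \<open>The exponent chosen by \<open>k\<close> is determined only modulo
    \<open>ord q\<close>, a multiple of \<open>p\<close>; so its residue modulo \<open>p\<close> is
    well defined.\<close>
  define k where "k x = (SOME n::int. x = q [^] n)" for x
  have k: "q [^] k x = x" if "x \<in> carrier G" for x
  proof -
    have "x \<in> range (\<lambda>n::int. q [^] n)"
      using that by (subst q(2)[symmetric])
    then obtain n :: int where "x = q [^] n"
      by blast
    then show ?thesis
      unfolding k_def by (metis (mono_tags, lifting) someI_ex)
  qed
  have cong: "m mod int p = n mod int p" if "q [^] m = q [^] n" for m n :: int
  proof -
    have "int (ord q) dvd n - m"
      using that int_pow_eq[OF q(1)] by blast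
    then have "int p dvd n - m"
      using dvd dvd_trans by blast
    then show ?thesis
      by (metis mod_eq_dvd_iff)
  qed
  let ?f = "\<lambda>x. k x mod int p"
  have "?f (x \<otimes> y) = (?f x + ?f y) mod int p" if "x \<in> carrier G" "y \<in> carrier G" for x y
  proof -
    have "q [^] k (x \<otimes> y) = q [^] (k x + k y)"
      using that k q(1) by (simp add: int_pow_mult)
    from cong[OF this] show ?thesis
      by (simp add: mod_add_eq)
  qed
  moreover have "n \<in> ?f ` carrier G" if "0 \<le> n" "n < int p" for n
  proof
    show "q [^] n \<in> carrier G"
      using q(1) by simp
    then show "n = ?f (q [^] n)"
      using cong[OF k] that by simp
  qed
  ultimately have "?f \<in> epi G (integer_mod_group p)"
    using assms(3) by (auto simp: epi_def hom_def carrier_integer_mod_group)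
  then show ?thesis by blast
qed

text \<open>All of \<open>S\<close> maps to one coset, which generates the quotient. Thus
  \<open>G Mod H\<close> is cyclic and nontrivial, and for a prime \<open>p\<close> dividing its
  order it maps onto the group of order \<open>p\<close>.\<close>

lemma (in normal) epi_integer_mod_group_of_coset_generates:
  assumes proper: "H \<noteq> carrier G" and S: "S \<subseteq> carrier G"
    and coset: "\<And>x y. x \<in> S \<Longrightarrow> y \<in> S \<Longrightarrow> H #> x = H #> y"
    and gen: "generate G S = carrier G"
  shows "\<exists>p f. prime p \<and> f \<in> epi G (integer_mod_group p) \<and> (\<forall>x\<in>H. f x = 0)"
proof -
  interpret Q: group "G Mod H" by (rule factorgroup_is_group)
  interpret r: group_hom G "G Mod H" "(#>) H"
    by unfold_locales (rule r_coset_hom_Mod)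
  have "S \<noteq> {}"
  proof
    assume "S = {}"
    then have "carrier G = {\<one>}"
      using gen generate_empty by simp
    then show False
      using subgroup.one_closed[OF is_subgroup] subset proper by auto
  qed
  then obtain a where a: "a \<in> S" by blast
  have "carrier (G Mod H) = generate (G Mod H) ((#>) H ` S)"
    using r.generate_img[OF S] gen by (simp add: carrier_FactGroup)
  also have "(#>) H ` S = {H #> a}"
    using a coset by blast
  finally have carr: "carrier (G Mod H) = generate (G Mod H) {H #> a}" .
  have aQ: "H #> a \<in> carrier (G Mod H)"
    using a S by (auto simp: carrier_FactGroup)
  have "carrier (G Mod H) = range (\<lambda>n::int. (H #> a) [^]\<^bsub>G Mod H\<^esub> n)"
    using carr Q.generate_pow[OF aQ] by auto
  then have cyc: "cyclic_group (G Mod H)"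
    using aQ Q.cyclic_group by blast
  have "order (G Mod H) \<noteq> 1"
  proof
    assume "order (G Mod H) = 1"
    then have triv: "carrier (G Mod H) = {H}"
      using Q.order_one_triv_iff by simp
    have "x \<in> H" if "x \<in> carrier G" for x
    proof -
      have "H #> x = H"
        using triv that by (auto simp: carrier_FactGroup)
      then show ?thesis
        using that rcos_self[OF that is_subgroup] by simp
    qed
    then show False
      using proper subset by blast
  qed
  \<comment> \<open>Such a prime exists for every order other than 1, including the value 0 that
    stands for an infinite quotient.\<close>
  then obtain p where p: "prime p" "p dvd order (G Mod H)"
    using prime_factor_nat by blast
  obtain f where f: "f \<in> epi (G Mod H) (integer_mod_group p)"
    using Q.cyclic_group_epi_integer_mod_group[OF cyc p(2) prime_gt_0_nat[OF p(1)]] by blast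
  let ?f = "f \<circ> (#>) H"
  have "?f \<in> epi G (integer_mod_group p)"
    using f Group.hom_compose[OF r_coset_hom_Mod]
    by (auto simp: epi_def carrier_FactGroup image_comp)
  moreover have "?f x = 0" if "x \<in> H" for x
  proof -
    have "H #> x = H"
      using that rcos_const by simp
    moreover have "f \<one>\<^bsub>G Mod H\<^esub> = \<one>\<^bsub>integer_mod_group p\<^esub>"
      using f by (intro hom_one) (auto simp: epi_def Q.is_group)
    ultimately show ?thesis by simp
  qed
  ultimately show ?thesis
    using p(1) by blast
qed

text \<open>The nonempty fibres of \<open>K\<close> over \<open>H1\<close> are the cosets of a normal subgroup \<open>N\<close> of \<open>H2\<close>. Since
  one of them generates \<open>H2\<close>, the quotient \<open>H2 / N\<close> is cyclic.\<close>

lemma subdirect_epi_integer_mod_group: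
  assumes "group H1" and "group H2"
    and K: "subgroup K (H1 \<times>\<times> H2)" "K \<noteq> carrier (H1 \<times>\<times> H2)"
    and fst_K: "fst ` K = carrier H1"
    and gen: "generate H2 {y. (w, y) \<in> K} = carrier H2"
  shows "\<exists>p f g. prime p \<and> f \<in> epi H1 (integer_mod_group p) \<and> g \<in> epi H2 (integer_mod_group p) \<and>
    (\<forall>(x, y)\<in>K. f x = g y)"
proof -
  interpret H1: group H1 by fact
  interpret H2: group H2 by fact
  interpret G: group "H1 \<times>\<times> H2" by (intro DirProd_group assms)
  interpret K: subgroup K "H1 \<times>\<times> H2" by (rule K(1))
  have Kcarr: "x \<in> carrier H1" "y \<in> carrier H2" if "(x, y) \<in> K" for x y
    using that K.subset by auto
  have Km: "(x \<otimes>\<^bsub>H1\<^esub> x', y \<otimes>\<^bsub>H2\<^esub> y') \<in> K" if "(x, y) \<in> K" "(x', y') \<in> K" for x y x' y'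
    using K.m_closed[OF that] by simp
  have Ki: "(inv\<^bsub>H1\<^esub> x, inv\<^bsub>H2\<^esub> y) \<in> K" if "(x, y) \<in> K" for x y
    using K.m_inv_closed[OF that] that Kcarr[OF that] assms(1,2) by simp
  have K1: "(\<one>\<^bsub>H1\<^esub>, \<one>\<^bsub>H2\<^esub>) \<in> K"
    using K.one_closed by simp
  define S where "S = {y. (w, y) \<in> K}"
  define N where "N = {y. (\<one>\<^bsub>H1\<^esub>, y) \<in> K}"
  have S: "S \<subseteq> carrier H2"
    using Kcarr by (auto simp: S_def)
  \<comment> \<open>The projection of \<open>K\<close> to \<open>H2\<close> is a subgroup containing
    the generating set \<open>S\<close>, so \<open>K\<close> projects onto both factors.\<close>
  have "subgroup (snd ` K) H2"
  proof (rule H2.subgroupI)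
    show "snd ` K \<subseteq> carrier H2" using Kcarr by auto
    show "snd ` K \<noteq> {}" using K1 by auto
    show "inv\<^bsub>H2\<^esub> y \<in> snd ` K" if "y \<in> snd ` K" for y
      using that Ki by force
    show "y \<otimes>\<^bsub>H2\<^esub> y' \<in> snd ` K" if "y \<in> snd ` K" "y' \<in> snd ` K" for y y'
      using that Km by force
  qed
  moreover have "S \<subseteq> snd ` K"
    by (force simp: S_def)
  ultimately have "generate H2 S \<subseteq> snd ` K"
    using H2.generate_subgroup_incl by blast
  then have snd_K: "carrier H2 \<subseteq> snd ` K"
    using gen by (simp add: S_def)
  have subN: "subgroup N H2"
  proof (rule H2.subgroupI)
    show "N \<subseteq> carrier H2" using Kcarr by (auto simp: N_def)
    show "N \<noteq> {}" using K1 by (auto simp: N_def)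
    show "inv\<^bsub>H2\<^esub> y \<in> N" if "y \<in> N" for y
      using that Ki[of "\<one>\<^bsub>H1\<^esub>" y] by (simp add: N_def)
    show "y \<otimes>\<^bsub>H2\<^esub> y' \<in> N" if "y \<in> N" "y' \<in> N" for y y'
      using that Km[of "\<one>\<^bsub>H1\<^esub>" y "\<one>\<^bsub>H1\<^esub>" y'] by (simp add: N_def)
  qed
  have normN: "N \<lhd> H2"
    unfolding H2.normal_inv_iff
  proof (intro conjI ballI subN)
    fix y n assume y: "y \<in> carrier H2" and n: "n \<in> N"
    \<comment> \<open>Normality rests on the second projection being onto: conjugating the pair of
      the identity and \<open>n\<close> by an element of \<open>K\<close> above \<open>y\<close>
      stays in \<open>K\<close>.\<close>
    obtain x where x: "(x, y) \<in> K"
      using y snd_K by force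
    have "(x \<otimes>\<^bsub>H1\<^esub> \<one>\<^bsub>H1\<^esub> \<otimes>\<^bsub>H1\<^esub> inv\<^bsub>H1\<^esub> x, y \<otimes>\<^bsub>H2\<^esub> n \<otimes>\<^bsub>H2\<^esub> inv\<^bsub>H2\<^esub> y) \<in> K"
      using n by (intro Km Ki x) (simp add: N_def)
    then show "y \<otimes>\<^bsub>H2\<^esub> n \<otimes>\<^bsub>H2\<^esub> inv\<^bsub>H2\<^esub> y \<in> N"
      using Kcarr[OF x] by (simp add: N_def)
  qed
  have diff: "y \<otimes>\<^bsub>H2\<^esub> inv\<^bsub>H2\<^esub> y' \<in> N" if "(x, y) \<in> K" "(x, y') \<in> K" for x y y'
    using Km[OF that(1) Ki[OF that(2)]] Kcarr[OF that(1)] by (simp add: N_def)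
  \<comment> \<open>If \<open>N\<close> were all of \<open>H2\<close>, every fibre over
    \<open>H1\<close> would be too, and \<open>K\<close> would be the whole product.\<close>
  have "N \<noteq> carrier H2"
  proof
    assume N: "N = carrier H2"
    have "(x, y) \<in> K" if x: "x \<in> carrier H1" and y: "y \<in> carrier H2" for x y
    proof -
      obtain y' where y': "(x, y') \<in> K"
        using x fst_K by force
      have "(\<one>\<^bsub>H1\<^esub>, y \<otimes>\<^bsub>H2\<^esub> inv\<^bsub>H2\<^esub> y') \<in> K"
        using N y Kcarr[OF y'] by (auto simp: N_def)
      from Km[OF this y'] show ?thesis
        using x y Kcarr[OF y'] by (simp add: H2.m_assoc)
    qed
    then show False
      using K(2) K.subset by auto
  qed
  moreover have "N #>\<^bsub>H2\<^esub> y = N #>\<^bsub>H2\<^esub> y'" if "y \<in> S" "y' \<in> S" for y y'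
  proof -
    have "y \<otimes>\<^bsub>H2\<^esub> inv\<^bsub>H2\<^esub> y' \<in> N" "y \<in> carrier H2" "y' \<in> carrier H2"
      using that diff Kcarr by (auto simp: S_def)
    moreover from this have "N #>\<^bsub>H2\<^esub> (y \<otimes>\<^bsub>H2\<^esub> inv\<^bsub>H2\<^esub> y') = N"
      using subN by (intro H2.coset_join2) auto
    ultimately show ?thesis
      using H2.coset_mult_inv1 subgroup.subset[OF subN] by blast
  qed
  ultimately obtain p g where p: "prime p" and g: "g \<in> epi H2 (integer_mod_group p)"
    and gN: "\<And>y. y \<in> N \<Longrightarrow> g y = 0"
    using normal.epi_integer_mod_group_of_coset_generates[OF normN _ S] gen
    unfolding S_def by metis
  interpret g: group_hom H2 "integer_mod_group p" g
    using g by (simp add: group_hom_def group_hom_axioms_def epi_def H2.is_group)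
  have g_eq: "g y = g y'" if "(x, y) \<in> K" "(x, y') \<in> K" for x y y'
  proof -
    have y: "y \<in> carrier H2" "y' \<in> carrier H2"
      using that Kcarr by auto
    have "g y = g ((y \<otimes>\<^bsub>H2\<^esub> inv\<^bsub>H2\<^esub> y') \<otimes>\<^bsub>H2\<^esub> y')"
      using y by (simp add: H2.m_assoc)
    also have "\<dots> = \<one>\<^bsub>integer_mod_group p\<^esub> \<otimes>\<^bsub>integer_mod_group p\<^esub> g y'"
      using y gN[OF diff[OF that]] by (subst g.hom_mult) (auto simp del: mult_integer_mod_group)
    also have "\<dots> = g y'"
      using y g.hom_closed g.H.l_one by blast
    finally show ?thesis .
  qed
  \<comment> \<open>Any partner of \<open>x\<close> in \<open>K\<close> will do, since
    \<open>g_eq\<close> makes \<open>g\<close> constant on fibres.\<close>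
  define f where "f x = g (SOME y. (x, y) \<in> K)" for x
  have f: "f x = g y" if "(x, y) \<in> K" for x y
    unfolding f_def by (rule g_eq[OF someI[of "\<lambda>y. (x, y) \<in> K", OF that] that])
  have "f \<in> hom H1 (integer_mod_group p)"
  proof (rule homI)
    fix x assume "x \<in> carrier H1"
    then obtain y where y: "(x, y) \<in> K"
      using fst_K by force
    then show "f x \<in> carrier (integer_mod_group p)"
      using f Kcarr by auto
    fix x' assume "x' \<in> carrier H1"
    then obtain y' where y': "(x', y') \<in> K"
      using fst_K by force
    show "f (x \<otimes>\<^bsub>H1\<^esub> x') = f x \<otimes>\<^bsub>integer_mod_group p\<^esub> f x'"
      using f[OF y] f[OF y'] f[OF Km[OF y y']] g.hom_mult Kcarr[OF y] Kcarr[OF y'] by metis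
  qed
  moreover have "f ` carrier H1 = carrier (integer_mod_group p)"
  proof -
    have "f ` carrier H1 = g ` snd ` K"
      unfolding fst_K[symmetric] image_image using f by (intro image_cong) auto
    also have "snd ` K = carrier H2"
      using snd_K Kcarr by auto
    finally show ?thesis
      using g by (simp add: epi_def)
  qed
  ultimately show ?thesis
    using p g f by (intro exI[of _ p] exI[of _ f] exI[of _ g]) (auto simp: epi_def)
qed

section \<open>Counting the members needed outside a kernel\<close>

text \<open>Take \<open>x\<close> outside the kernel, of order a power of \<open>p\<close>. A subgroup of the cover that contains
  two of the elements \<open>z x\<^sup>i\<close>, or one of them together with \<open>x\<close>, contains \<open>x\<close> and then \<open>z\<close>; hence \<open>x\<close>
  and the \<open>z x\<^sup>i\<close> with \<open>0 < i < p\<close> lie in \<open>p\<close> different members.\<close>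

lemma (in group) le_card_cover_outside_kernel:
  assumes fin: "finite (carrier G)" and p: "prime p"
    and h: "h \<in> epi G (integer_mod_group p)"
    and D: "finite D" "\<And>L. L \<in> D \<Longrightarrow> subgroup L G"
    and cover: "\<And>x. x \<in> carrier G \<Longrightarrow> h x \<noteq> 0 \<Longrightarrow> x \<in> \<Union>D"
    and z: "z \<in> carrier G" "h z = 0" "z \<notin> \<Union>D"
  shows "p \<le> card D"
proof -
  interpret h: group_hom G "integer_mod_group p" h
    using h by (simp add: group_hom_def group_hom_axioms_def epi_def)
  have p1: "1 < p" using p prime_gt_1_nat by blast
  have "1 \<in> h ` carrier G"
    using h p1 by (simp add: epi_def carrier_integer_mod_group)
  then obtain x0 where x0: "x0 \<in> carrier G" "h x0 = 1"
    by (metis imageE)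
  have "order G \<noteq> 0" using fin by (simp add: order_gt_0_iff_finite)
  moreover have "\<not> is_unit p" using p not_prime_unit by blast
  ultimately obtain m where m: "order G = p ^ multiplicity p (order G) * m" "\<not> p dvd m"
    by (rule multiplicity_decompose')
  define k where "k = multiplicity p (order G)"
  \<comment> \<open>Raising \<open>x0\<close> to the \<open>p\<close>-free part \<open>m\<close> of
    the group order gives an element of \<open>p\<close>-power order. It stays outside the kernel
    because its value is \<open>m\<close> modulo \<open>p\<close>.\<close>
  define x where "x = x0 [^] m"
  have x: "x \<in> carrier G" using x0 by (simp add: x_def)
  have hpow: "h (y [^] n) = int n * h y mod int p" if "y \<in> carrier G" for y and n :: nat
    using that h.hom_nat_pow by simp
  have "x [^] (p ^ k) = \<one>"
    using x0 pow_order_eq_1[OF x0(1)] m(1) by (simp add: x_def nat_pow_pow mult.commute k_def)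
  then have xp: "x [^] int (p ^ k) = \<one>"
    by (simp only: int_pow_int)
  have hx: "\<not> int p dvd h x"
    using hpow[OF x0(1), of m] x0(2) m(2) by (simp add: x_def dvd_mod_iff)
  \<comment> \<open>\<open>d\<close> is invertible modulo \<open>p ^ k\<close>, so \<open>x\<close>
    is a power of \<open>x [^] d\<close>.\<close>
  have root: "x \<in> L" if L: "L \<in> D" "x [^] d \<in> L" "\<not> int p dvd d" for L and d :: int
  proof -
    have "coprime d (int p)"
      using L(3) p prime_imp_coprime[of "int p" d] by (simp add: coprime_commute)
    then have "coprime d (int (p ^ k))"
      by simp
    then obtain u v where uv: "u * d + v * int (p ^ k) = 1"
      using bezout_int[of d "int (p ^ k)"] by (auto simp: coprime_iff_gcd_eq_1)
    have "x = x [^] (d * u + int (p ^ k) * v)"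
      using uv x by (simp add: mult.commute)
    also have "\<dots> = (x [^] d) [^] u \<otimes> (x [^] int (p ^ k)) [^] v"
      using x by (simp add: int_pow_mult int_pow_pow)
    also have "\<dots> = (x [^] d) [^] u"
      unfolding xp using x by simp
    also have "\<dots> \<in> L"
      using subgroup_int_pow_closed D(2) L by blast
    finally show ?thesis .
  qed
  \<comment> \<open>Index 0 stands for \<open>x\<close> instead of \<open>z\<close>, which lies in
    the kernel and in no member; this gives \<open>p\<close> elements outside the kernel.\<close>
  define y where "y i = (if i = 0 then x else z \<otimes> x [^] i)" for i :: nat
  have y: "y i \<in> carrier G" "h (y i) \<noteq> 0" if "i < p" for i
  proof -
    show "y i \<in> carrier G" using x z by (simp add: y_def)
    show "h (y i) \<noteq> 0"
    proof (cases "i = 0")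
      case True
      then show ?thesis using hx by (auto simp: y_def)
    next
      case False
      then have "\<not> int p dvd int i"
        using that by (simp add: nat_dvd_not_less)
      then have "\<not> int p dvd int i * h x"
        using hx p by (simp add: prime_dvd_mult_iff)
      moreover have "h (y i) = int i * h x mod int p"
        using False x z hpow[OF x, of i] by (simp add: y_def)
      ultimately show ?thesis
        by (simp add: dvd_eq_mod_eq_0)
    qed
  qed
  then have "\<forall>i<p. \<exists>L\<in>D. y i \<in> L"
    using cover by blast
  then obtain L where L: "\<And>i. i < p \<Longrightarrow> L i \<in> D \<and> y i \<in> L i"
    by metis
  have no_x: "x \<notin> L i" if "0 < i" "i < p" for i
  proof
    assume "x \<in> L i"
    have sub: "subgroup (L i) G" using L D that by blast
    interpret Li: subgroup "L i" G by (rule sub)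
    have "z \<otimes> x [^] i \<otimes> inv (x [^] i) \<in> L i"
      using L[OF that(2)] that(1) \<open>x \<in> L i\<close> nat_pow_closed
      by (metis Li.m_closed Li.m_inv_closed int_pow_int less_not_refl sub subgroup_int_pow_closed y_def)
    then have "z \<in> L i" using x z by (simp add: m_assoc)
    then show False using z(3) L[OF that(2)] by blast
  qed
  have neq: "L i \<noteq> L j" if ij: "i < j" "j < p" for i j
  proof
    assume eq: "L i = L j"
    have sub: "subgroup (L j) G" using L D that by blast
    interpret Lj: subgroup "L j" G by (rule sub)
    show False
    proof (cases "i = 0")
      case True
      then show False using eq no_x[of j] L[of 0] ij by (simp add: y_def)
    next
      case False
      have "y i \<in> L j" "y j \<in> L j"
        using L[of i] L[of j] eq ij by simp_all
      then have "z \<otimes> x [^] i \<in> L j" "z \<otimes> x [^] j \<in> L j"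
        using False ij by (simp_all add: y_def)
      \<comment> \<open>This quotient cancels \<open>z\<close> and leaves a power of
        \<open>x\<close> whose exponent \<open>j - i\<close> lies strictly between 0 and
        \<open>p\<close>.\<close>
      then have "inv (z \<otimes> x [^] i) \<otimes> (z \<otimes> x [^] j) \<in> L j"
        by blast
      also have "inv (z \<otimes> x [^] i) \<otimes> (z \<otimes> x [^] j) = inv (x [^] i) \<otimes> x [^] j"
        using x z by (simp add: inv_mult_group m_assoc inv_solve_left')
      also have "\<dots> = x [^] (int j - int i)"
      proof -
        have "x [^] (int j - int i) = x [^] (- int i + int j)" by simp
        also have "\<dots> = inv (x [^] i) \<otimes> x [^] j"
          using x by (simp only: int_pow_mult int_pow_neg int_pow_int)
        finally show ?thesis by simp
      qed
      finally have "x [^] (int j - int i) \<in> L j" .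
      moreover have "\<not> int p dvd int j - int i"
        using ij by (simp add: zdvd_not_zless)
      ultimately have "x \<in> L j"
        using root[of "L j" "int j - int i"] L[of j] ij by simp
      then show False using no_x[of j] ij by simp
    qed
  qed
  have "inj_on L {..<p}"
    by (rule linorder_inj_onI) (use neq in auto)
  then have "card {..<p} \<le> card D"
    using L D(1) by (intro card_inj_on_le[of L]) auto
  then show ?thesis by simp
qed

section \<open>The value \<open>p + 1\<close> as upper and lower bound\<close>

text \<open>The kernels of these forms are the lines in the upper bound. Coefficients -1 and 1 give
  the form vanishing where \<open>f\<close> and \<open>g\<close> agree, used for the lower
  bound.\<close>

lemma hom_DirProd_integer_mod_group_combination:
  assumes "f \<in> hom H1 (integer_mod_group p)" and "g \<in> hom H2 (integer_mod_group p)" and "p > 0"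
  shows "(\<lambda>(x, y). (c * f x + d * g y) mod int p) \<in> hom (H1 \<times>\<times> H2) (integer_mod_group p)"
proof (rule homI)
  fix u v assume "u \<in> carrier (H1 \<times>\<times> H2)" and "v \<in> carrier (H1 \<times>\<times> H2)"
  then obtain x y x' y' where uv: "u = (x, y)" "v = (x', y')" "x \<in> carrier H1" "x' \<in> carrier H1"
    "y \<in> carrier H2" "y' \<in> carrier H2" by auto
  have "f (x \<otimes>\<^bsub>H1\<^esub> x') = (f x + f x') mod int p" "g (y \<otimes>\<^bsub>H2\<^esub> y') = (g y + g y') mod int p"
    using assms uv by (simp_all add: hom_mult)
  moreover have "(c * ((f x + f x') mod int p) + d * ((g y + g y') mod int p)) mod int p =
    (c * f x + d * g y + (c * f x' + d * g y')) mod int p"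
  proof -
    have "(c * ((f x + f x') mod int p) + d * ((g y + g y') mod int p)) mod int p =
        (c * (f x + f x') + d * (g y + g y')) mod int p"
      by (metis (no_types, lifting) mod_add_eq mod_mult_right_eq)
    then show ?thesis by (simp add: algebra_simps)
  qed
  ultimately show "(case u \<otimes>\<^bsub>H1 \<times>\<times> H2\<^esub> v of (x, y) \<Rightarrow> (c * f x + d * g y) mod int p) =
      (case u of (x, y) \<Rightarrow> (c * f x + d * g y) mod int p) \<otimes>\<^bsub>integer_mod_group p\<^esub>
      (case v of (x, y) \<Rightarrow> (c * f x + d * g y) mod int p)"
    by (simp add: uv mod_add_eq)
qed (use assms(3) in \<open>auto simp: carrier_integer_mod_group\<close>)

text \<open>The cover consists of the preimages of the \<open>p + 1\<close> lines through the origin of the plane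
  over the field with \<open>p\<close> elements.\<close>

lemma covering_number_DirProd_le_prime:
  assumes "group H1" and "group H2" and p: "prime p"
    and f: "f \<in> epi H1 (integer_mod_group p)" and g: "g \<in> epi H2 (integer_mod_group p)"
  shows "covering_number (H1 \<times>\<times> H2) \<le> enat (p + 1)"
proof -
  interpret H1: group H1 by fact
  interpret H2: group H2 by fact
  interpret G: group "H1 \<times>\<times> H2" by (intro DirProd_group assms)
  have p1: "1 < p" using p prime_gt_1_nat by blast
  have hom: "f \<in> hom H1 (integer_mod_group p)" "g \<in> hom H2 (integer_mod_group p)"
    and surj: "f ` carrier H1 = {0..<int p}" "g ` carrier H2 = {0..<int p}"
    using f g p1 by (auto simp: epi_def carrier_integer_mod_group)
  have one: "f \<one>\<^bsub>H1\<^esub> = 0" "g \<one>\<^bsub>H2\<^esub> = 0"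
    using hom_one[OF hom(1) assms(1)] hom_one[OF hom(2) assms(2)] by simp_all
  have "1 \<in> f ` carrier H1" "1 \<in> g ` carrier H2"
    unfolding surj using p1 by simp_all
  then obtain a b where ab: "a \<in> carrier H1" "f a = 1" "b \<in> carrier H2" "g b = 1"
    by (metis imageE)
  define l where "l c d = kernel (H1 \<times>\<times> H2) (integer_mod_group p)
    (\<lambda>(x, y). (c * f x + d * g y) mod int p)" for c d
  have l_iff: "(x, y) \<in> l c d \<longleftrightarrow> x \<in> carrier H1 \<and> y \<in> carrier H2 \<and> (c * f x + d * g y) mod int p = 0"
    for x y c d by (auto simp: l_def kernel_def)
  have subg: "subgroup (l c d) (H1 \<times>\<times> H2)" for c d
  proof -
    interpret group_hom "H1 \<times>\<times> H2" "integer_mod_group p" "\<lambda>(x, y). (c * f x + d * g y) mod int p"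
      using hom_DirProd_integer_mod_group_combination[OF hom] p1 G.is_group
      by (simp add: group_hom_def group_hom_axioms_def)
    show ?thesis unfolding l_def by (rule subgroup_kernel)
  qed
  \<comment> \<open>With X and Y the values of \<open>f\<close> and \<open>g\<close>, these are the
    line X = 0 and the \<open>p\<close> lines Y = -cX.\<close>
  let ?C = "insert (l 1 0) ((\<lambda>c. l c 1) ` {0..<int p})"
  \<comment> \<open>At these lifts of 1 the defining forms take the value 1, which is nonzero modulo
    \<open>p\<close>.\<close>
  have "(a, \<one>\<^bsub>H2\<^esub>) \<notin> l 1 0" "(\<one>\<^bsub>H1\<^esub>, b) \<notin> l c 1" for c
    using ab one p1 by (auto simp: l_iff)
  then have proper: "l 1 0 \<noteq> carrier (H1 \<times>\<times> H2)" "l c 1 \<noteq> carrier (H1 \<times>\<times> H2)" for c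
    using ab by auto
  have cover: "(x, y) \<in> \<Union>?C" if xy: "x \<in> carrier H1" "y \<in> carrier H2" for x y
  proof (cases "f x = 0")
    case True
    then show ?thesis using xy by (auto simp: l_iff)
  next
    case False
    have "f x \<in> {0..<int p}" using xy surj by blast
    then have "\<not> int p dvd f x"
      using False by (simp add: zdvd_not_zless)
    then have "coprime (f x) (int p)"
      using p prime_imp_coprime[of "int p" "f x"] by (simp add: coprime_commute)
    then obtain u v where uv: "u * f x + v * int p = 1"
      using bezout_int[of "f x" "int p"] by (auto simp: coprime_iff_gcd_eq_1)
    \<comment> \<open>\<open>u\<close> inverts \<open>f x\<close> modulo \<open>p\<close>, so the
      line through the point \<open>(f x, g y)\<close> has coefficient
      \<open>- (u * g y)\<close>.\<close>
    have "(- (u * g y) * f x + g y) = int p * (v * g y)"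
    proof -
      have "(- (u * g y) * f x + g y) = g y * (u * f x + v * int p) - u * g y * f x"
        using uv by simp
      then show ?thesis by (simp add: algebra_simps)
    qed
    then have "(- (u * g y) * f x + g y) mod int p = 0" by simp
    then have "((- (u * g y) mod int p) * f x + 1 * g y) mod int p = 0"
      by (metis mod_add_left_eq mod_mult_left_eq mult_1)
    then have "(x, y) \<in> l (- (u * g y) mod int p) 1"
      using xy by (simp add: l_iff)
    moreover have "- (u * g y) mod int p \<in> {0..<int p}" using p1 by simp
    ultimately show ?thesis by blast
  qed
  have "\<Union>?C = carrier (H1 \<times>\<times> H2)"
  proof
    show "\<Union>?C \<subseteq> carrier (H1 \<times>\<times> H2)" using subgroup.subset[OF subg] by blast
    show "carrier (H1 \<times>\<times> H2) \<subseteq> \<Union>?C" using cover by auto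
  qed
  then have "group_cover (H1 \<times>\<times> H2) ?C"
    unfolding group_cover_def using subg proper by auto
  then have "covering_number (H1 \<times>\<times> H2) \<le> enat (card ?C)"
    by (rule G.covering_number_le_card)
  also have "card ?C \<le> Suc (card ((\<lambda>c. l c 1) ` {0..<int p}))"
    by (rule card_insert_le_m1) auto
  also have "card ((\<lambda>c. l c 1) ` {0..<int p}) \<le> p"
    using card_image_le[of "{0..<int p}" "\<lambda>c. l c 1"] by simp
  finally show ?thesis by simp
qed

text \<open>\<open>K\<close> lies in the kernel of g - f. By minimality the other members miss some
  point, necessarily in \<open>K\<close>, yet they cover everything outside that kernel. Hence there
  are at least \<open>p\<close> of them, and \<open>K\<close> is one more.\<close>

lemma minimal_cover_DirProd_ge_prime:
  assumes "group H1" and "finite (carrier H1)" and "group H2" and "finite (carrier H2)"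
    and p: "prime p"
    and f: "f \<in> epi H1 (integer_mod_group p)" and g: "g \<in> epi H2 (integer_mod_group p)"
    and C: "minimal_group_cover (H1 \<times>\<times> H2) C" and K: "K \<in> C" "\<forall>(x, y)\<in>K. f x = g y"
  shows "p + 1 \<le> card C"
proof -
  interpret H1: group H1 by fact
  interpret H2: group H2 by fact
  interpret G: group "H1 \<times>\<times> H2" by (intro DirProd_group assms)
  have p1: "1 < p" using p prime_gt_1_nat by blast
  have hom: "f \<in> hom H1 (integer_mod_group p)" "g \<in> hom H2 (integer_mod_group p)"
    and surj: "f ` carrier H1 = {0..<int p}" "g ` carrier H2 = {0..<int p}"
    using f g p1 by (auto simp: epi_def carrier_integer_mod_group)
  define h where "h = (\<lambda>(x, y). (- 1 * f x + 1 * g y) mod int p)"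
  have h_hom: "h \<in> hom (H1 \<times>\<times> H2) (integer_mod_group p)"
    unfolding h_def using hom p1 by (intro hom_DirProd_integer_mod_group_combination) auto
  \<comment> \<open>Pairs whose first component is the identity already reach every value.\<close>
  have "n \<in> h ` carrier (H1 \<times>\<times> H2)" if n: "n \<in> {0..<int p}" for n
  proof -
    obtain y where y: "y \<in> carrier H2" "g y = n"
      using n surj by (metis imageE)
    have "h (\<one>\<^bsub>H1\<^esub>, y) = n"
      using hom_one[OF hom(1) assms(1)] y n by (simp add: h_def)
    then show ?thesis using y by force
  qed
  then have h: "h \<in> epi (H1 \<times>\<times> H2) (integer_mod_group p)"
    using h_hom p1 by (auto simp: epi_def carrier_integer_mod_group hom_def)
  have cov: "group_cover (H1 \<times>\<times> H2) C" and min: "\<And>D. group_cover (H1 \<times>\<times> H2) D \<Longrightarrow> card C \<le> card D"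
    using C by (auto simp: minimal_group_cover_def)
  let ?D = "C - {K}"
  have hK: "h u = 0" if "u \<in> K" for u
    using that K(2) by (auto simp: h_def)
  have "finite C" using cov by (simp add: group_cover_def)
  then have cardD: "card C = Suc (card ?D)"
    using card_Suc_Diff1[OF _ K(1)] by simp
  then have "\<not> group_cover (H1 \<times>\<times> H2) ?D"
    using min[of ?D] by auto
  then have "\<Union>?D \<noteq> carrier (H1 \<times>\<times> H2)"
    using cov unfolding group_cover_def by blast
  moreover have "\<Union>?D \<subseteq> carrier (H1 \<times>\<times> H2)"
    using cov unfolding group_cover_def by blast
  ultimately obtain z where z: "z \<in> carrier (H1 \<times>\<times> H2)" "z \<notin> \<Union>?D"
    by blast
  have out: "u \<in> K \<or> u \<in> \<Union>?D" if "u \<in> carrier (H1 \<times>\<times> H2)" for u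
    using that cov unfolding group_cover_def by blast
  have "p \<le> card ?D"
  proof (rule G.le_card_cover_outside_kernel[OF _ p h])
    show "finite (carrier (H1 \<times>\<times> H2))" using assms by simp
    show "finite ?D" using \<open>finite C\<close> by simp
    show "subgroup L (H1 \<times>\<times> H2)" if "L \<in> ?D" for L
      using that cov by (simp add: group_cover_def)
    show "u \<in> \<Union>?D" if "u \<in> carrier (H1 \<times>\<times> H2)" "h u \<noteq> 0" for u
      using out[OF that(1)] hK that(2) by blast
    show "h z = 0" using out[OF z(1)] hK z(2) by blast
  qed (use z in auto)
  then show ?thesis using cardD by simp
qed

section \<open>Covering number of a product against those of its factors\<close>

theorem theorem1:
  fixes H1 :: "('a, 'c) monoid_scheme" and H2 :: "('b, 'd) monoid_scheme"
  assumes "group H1" and "finite (carrier H1)"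
    and "group H2" and "finite (carrier H2)"
  shows "covering_number (H1 \<times>\<times> H2) = min (covering_number H1) (covering_number H2) \<or>
    (\<exists>p::nat. prime p \<and> covering_number (H1 \<times>\<times> H2) = enat (p + 1) \<and>
       (\<exists>f. f \<in> epi H1 (integer_mod_group p)) \<and>
       (\<exists>g. g \<in> epi H2 (integer_mod_group p)))"
proof -
  interpret H1: group H1 by fact
  interpret H2: group H2 by fact
  interpret G: group "H1 \<times>\<times> H2" by (intro DirProd_group assms)
  have "fst ` (carrier H1 \<times> carrier H2) = carrier H1" "snd ` (carrier H1 \<times> carrier H2) = carrier H2"
    using H1.one_closed H2.one_closed by force+
  then have proj: "fst \<in> epi (H1 \<times>\<times> H2) H1" "snd \<in> epi (H1 \<times>\<times> H2) H2"
    by (auto simp: epi_def hom_def)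
  interpret fst: group_hom "H1 \<times>\<times> H2" H1 fst
    using proj by unfold_locales (simp add: epi_def)
  have le: "covering_number (H1 \<times>\<times> H2) \<le> min (covering_number H1) (covering_number H2)"
    using covering_number_epi_le[OF G.is_group assms(1,2) proj(1)]
      covering_number_epi_le[OF G.is_group assms(3,4) proj(2)] by simp
  show ?thesis
  proof (cases "cyclic_group (H1 \<times>\<times> H2)")
    case True
    then have "covering_number (H1 \<times>\<times> H2) = \<infinity>" by (simp add: covering_number_def)
    \<comment> \<open>The bound \<open>le\<close> makes the minimum infinite as well.\<close>
    then show ?thesis using le by (simp add: min_def split: if_splits)
  next
    case False
    have finG: "finite (carrier (H1 \<times>\<times> H2))" using assms by simp
    obtain C where C: "minimal_group_cover (H1 \<times>\<times> H2) C"
      using G.minimal_group_cover_exists[OF finG False] by blast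
    have num: "covering_number (H1 \<times>\<times> H2) = enat (card C)"
      by (rule covering_number_eq_card[OF False C])
    have cov: "finite C" "\<And>K. K \<in> C \<Longrightarrow> subgroup K (H1 \<times>\<times> H2)"
      "\<And>K. K \<in> C \<Longrightarrow> K \<noteq> carrier (H1 \<times>\<times> H2)" "\<Union>C = carrier (H1 \<times>\<times> H2)"
      using C by (auto simp: minimal_group_cover_def group_cover_def)
    let ?fibre = "\<lambda>w K. {y. (w, y) \<in> K}"
    show ?thesis
    \<comment> \<open>Such a \<open>K\<close> leads to the prime alternative; without one, a cover
      of a factor is read off from \<open>C\<close>.\<close>
    proof (cases "\<exists>K\<in>C. \<exists>w. fst ` K = carrier H1 \<and> generate H2 (?fibre w K) = carrier H2")
      case True
      then obtain K w where K: "K \<in> C" "fst ` K = carrier H1" "generate H2 (?fibre w K) = carrier H2"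
        by blast
      obtain p f g where p: "prime p" and f: "f \<in> epi H1 (integer_mod_group p)"
        and g: "g \<in> epi H2 (integer_mod_group p)" and fg: "\<forall>(x, y)\<in>K. f x = g y"
        using subdirect_epi_integer_mod_group[OF assms(1,3) cov(2,3)[OF K(1)] K(2,3)] by blast
      have "covering_number (H1 \<times>\<times> H2) = enat (p + 1)"
        using covering_number_DirProd_le_prime[OF assms(1,3) p f g]
          minimal_cover_DirProd_ge_prime[OF assms p f g C K(1) fg] num by simp
      then show ?thesis using p f g by blast
    next
      case False
      let ?A = "{K \<in> C. fst ` K \<noteq> carrier H1}"
      have "covering_number H1 \<le> enat (card C) \<or> covering_number H2 \<le> enat (card C)"
      proof (cases "carrier H1 \<subseteq> \<Union>((`) fst ` ?A)")
        case True
        have "subgroup (fst ` K) H1" if "K \<in> C" for K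
          using fst.subgroup_img_is_subgroup[OF cov(2)[OF that]] .
        moreover from this have "\<Union>((`) fst ` ?A) = carrier H1"
          using True subgroup.subset by blast
        ultimately have "group_cover H1 ((`) fst ` ?A)"
          unfolding group_cover_def using cov(1) by auto
        then have "covering_number H1 \<le> enat (card ((`) fst ` ?A))"
          by (rule H1.covering_number_le_card)
        also have "\<dots> \<le> enat (card ?A)"
          using cov(1) by (simp add: card_image_le)
        also have "\<dots> \<le> enat (card C)"
          using cov(1) by (auto intro: card_mono)
        finally show ?thesis by blast
      next
        case outside: False
        obtain w where w: "w \<in> carrier H1" "w \<notin> \<Union>((`) fst ` ?A)"
          using outside by (meson subsetI)
        let ?B = "(\<lambda>K. generate H2 (?fibre w K)) ` (C - ?A)"
        have fibre: "?fibre w K \<subseteq> carrier H2" if "K \<in> C" for K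
          using subgroup.subset[OF cov(2)[OF that]] by auto
        have sub: "subgroup (generate H2 (?fibre w K)) H2" if "K \<in> C" for K
          using H2.generate_is_subgroup[OF fibre[OF that]] .
        have "y \<in> \<Union>?B" if "y \<in> carrier H2" for y
        proof -
          have "(w, y) \<in> \<Union>C"
            unfolding cov(4) using that w(1) by simp
          \<comment> \<open>The projection of this \<open>K\<close> contains \<open>w\<close>, which
            every projection of a member of \<open>?A\<close> misses; so \<open>K\<close> projects
            onto \<open>H1\<close>.\<close>
          then obtain K where K: "K \<in> C" "(w, y) \<in> K"
            by blast
          then have "w \<in> fst ` K" by force
          then have "K \<notin> ?A" using w(2) by blast
          then show ?thesis using K by (auto intro: generate.incl)
        qed
        then have "\<Union>?B = carrier H2"
          using sub subgroup.subset by blast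
        \<comment> \<open>Properness comes from \<open>False\<close>: no member projecting onto
          \<open>H1\<close> has a fibre generating \<open>H2\<close>.\<close>
        then have "group_cover H2 ?B"
          unfolding group_cover_def using cov(1) sub False by auto
        then have "covering_number H2 \<le> enat (card ?B)"
          by (rule H2.covering_number_le_card)
        also have "\<dots> \<le> enat (card (C - ?A))"
          using cov(1) by (simp add: card_image_le)
        also have "\<dots> \<le> enat (card C)"
          using cov(1) by (auto intro: card_mono)
        finally show ?thesis by blast
      qed
      then have "min (covering_number H1) (covering_number H2) \<le> covering_number (H1 \<times>\<times> H2)"
        using num by (auto simp: min_le_iff_disj)
      then show ?thesis using le by simp
    qed
  qed
qed

end
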